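(* Let $S$ be an AG-groupoid with left identity. Then the following conditions are equivalent: (i) $S$ is intra-regular; (ii) for every right ideal $R$ and every left ideal $L$ of $S$, $R\cap L=RL$ and $R$ is semiprime; (iii) for every intuitionistic fuzzy right ideal $A=(\mu_A,\gamma_A)$ and every intuitionistic fuzzy left ideal $B=(\mu_B,\gamma_B)$ of $S$, $A\cap B=A\circ B$ and $A$ is intuitionistic fuzzy semiprime.
   Context: An AG-groupoid is a non-empty set $S$ with a binary operation satisfying the left invertive law $(ab)c=(cb)a$ for all $a,b,c\in S$ (no associativity is assumed); $a^2$ denotes $aa$. A left identity is an element $e\in S$ with $ea=a$ for all $a\in S$. $S$ is intra-regular if for every $a\in S$ there are $x,y\in S$ with $a=(xa^2)y$. For subsets $X,Y\subseteq S$, $XY=\{xy: x\in X,y\in Y\}$. A non-empty subset $X\subseteq S$ is a left ideal if $SX\subseteq X$ and a right ideal if $XS\subseteq X$. A subset $X$ is semiprime if $a^2\in X$ implies $a\in X$. An intuitionistic fuzzy set (IFS) of $S$ is a pair $A=(\mu_A,\gamma_A)$ of functions $\mu_A,\gamma_A:S\to[0,1]$ with $0\le \mu_A(x)+\gamma_A(x)\le 1$ for all $x\in S$. An IFS $A$ is an intuitionistic fuzzy left ideal if $\mu_A(xy)\ge\mu_A(y)$ and $\gamma_A(xy)\le\gamma_A(y)$ for all $x,y\in S$, and an intuitionistic fuzzy right ideal if $\mu_A(xy)\ge\mu_A(x)$ and $\gamma_A(xy)\le\gamma_A(x)$ for all $x,y\in S$. An IFS $A$ is intuitionistic fuzzy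 semiprime if $\mu_A(a)\ge\mu_A(a^2)$ and $\gamma_A(a)\le\gamma_A(a^2)$ for all $a\in S$. $A\cap B$ is the IFS with membership function $x\mapsto\min\{\mu_A(x),\mu_B(x)\}$ and non-membership function $x\mapsto\max\{\gamma_A(x),\gamma_B(x)\}$. The product is $A\circ B=(\mu_A\circ\mu_B,\gamma_A\circ\gamma_B)$, where $(\mu_A\circ\mu_B)(a)=\sup_{a=bc}\min\{\mu_A(b),\mu_B(c)\}$ if $a=bc$ for some $b,c\in S$ and $0$ otherwise, and $(\gamma_A\circ\gamma_B)(a)=\inf_{a=bc}\max\{\gamma_A(b),\gamma_B(c)\}$ if $a=bc$ for some $b,c\in S$ and $1$ otherwise. *)

theory Defs
  imports Complex_Main "HOL-Library.FuncSet"
begin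

locale ag_groupoid =
  fixes S :: "'a set" and f :: "'a \<Rightarrow> 'a \<Rightarrow> 'a" (infixl \<open>\<cdot>\<close> 70)
  assumes nonempty: "S \<noteq> {}"
    and closed: "\<lbrakk>a \<in> S; b \<in> S\<rbrakk> \<Longrightarrow> a \<cdot> b \<in> S"
    and left_invertive: "\<lbrakk>a \<in> S; b \<in> S; c \<in> S\<rbrakk> \<Longrightarrow> (a \<cdot> b) \<cdot> c = (c \<cdot> b) \<cdot> a"

definition left_identity :: "'a set \<Rightarrow> ('a \<Rightarrow> 'a \<Rightarrow> 'a) \<Rightarrow> 'a \<Rightarrow> bool" where
  "left_identity S f e \<longleftrightarrow> e \<in> S \<and> (\<forall>a\<in>S. f e a = a)"

definition intra_regular :: "'a set \<Rightarrow> ('a \<Rightarrow> 'a \<Rightarrow> 'a) \<Rightarrow> bool" where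
  "intra_regular S f \<longleftrightarrow> (\<forall>a\<in>S. \<exists>x\<in>S. \<exists>y\<in>S. a = f (f x (f a a)) y)"

definition set_mult :: "('a \<Rightarrow> 'a \<Rightarrow> 'a) \<Rightarrow> 'a set \<Rightarrow> 'a set \<Rightarrow> 'a set" where
  "set_mult f X Y = {f x y | x y. x \<in> X \<and> y \<in> Y}"

definition left_ideal :: "'a set \<Rightarrow> ('a \<Rightarrow> 'a \<Rightarrow> 'a) \<Rightarrow> 'a set \<Rightarrow> bool" where
  "left_ideal S f X \<longleftrightarrow> X \<noteq> {} \<and> X \<subseteq> S \<and> set_mult f S X \<subseteq> X"

definition right_ideal :: "'a set \<Rightarrow> ('a \<Rightarrow> 'a \<Rightarrow> 'a) \<Rightarrow> 'a set \<Rightarrow> bool" where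
  "right_ideal S f X \<longleftrightarrow> X \<noteq> {} \<and> X \<subseteq> S \<and> set_mult f X S \<subseteq> X"

definition semiprime :: "'a set \<Rightarrow> ('a \<Rightarrow> 'a \<Rightarrow> 'a) \<Rightarrow> 'a set \<Rightarrow> bool" where
  "semiprime S f X \<longleftrightarrow> (\<forall>a\<in>S. f a a \<in> X \<longrightarrow> a \<in> X)"

text \<open>The two components of an intuitionistic fuzzy set are functions from the carrier to
  the unit interval. They are taken to be extensional (equal to \<^const>\<open>undefined\<close> off the
  carrier), so that equality of such pairs is equality of functions on the carrier.\<close>

type_synonym 'a fuzzy_pair = "('a \<Rightarrow> real) \<times> ('a \<Rightarrow> real)"

abbreviation membership :: "'a fuzzy_pair \<Rightarrow> 'a \<Rightarrow> real" (\<open>\<mu>\<close>) where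
  "\<mu> A \<equiv> fst A"

abbreviation nonmembership :: "'a fuzzy_pair \<Rightarrow> 'a \<Rightarrow> real" (\<open>\<gamma>\<close>) where
  "\<gamma> A \<equiv> snd A"

definition ifs :: "'a set \<Rightarrow> 'a fuzzy_pair \<Rightarrow> bool" where
  "ifs S A \<longleftrightarrow> \<mu> A \<in> S \<rightarrow>\<^sub>E {0..1} \<and> \<gamma> A \<in> S \<rightarrow>\<^sub>E {0..1} \<and>
     (\<forall>x\<in>S. 0 \<le> \<mu> A x + \<gamma> A x \<and> \<mu> A x + \<gamma> A x \<le> 1)"

definition if_left_ideal :: "'a set \<Rightarrow> ('a \<Rightarrow> 'a \<Rightarrow> 'a) \<Rightarrow> 'a fuzzy_pair \<Rightarrow> bool" where
  "if_left_ideal S f A \<longleftrightarrow> ifs S A \<and>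
     (\<forall>x\<in>S. \<forall>y\<in>S. \<mu> A (f x y) \<ge> \<mu> A y \<and> \<gamma> A (f x y) \<le> \<gamma> A y)"

definition if_right_ideal :: "'a set \<Rightarrow> ('a \<Rightarrow> 'a \<Rightarrow> 'a) \<Rightarrow> 'a fuzzy_pair \<Rightarrow> bool" where
  "if_right_ideal S f A \<longleftrightarrow> ifs S A \<and>
     (\<forall>x\<in>S. \<forall>y\<in>S. \<mu> A (f x y) \<ge> \<mu> A x \<and> \<gamma> A (f x y) \<le> \<gamma> A x)"

definition if_semiprime :: "'a set \<Rightarrow> ('a \<Rightarrow> 'a \<Rightarrow> 'a) \<Rightarrow> 'a fuzzy_pair \<Rightarrow> bool" where
  "if_semiprime S f A \<longleftrightarrow> ifs S A \<and>
     (\<forall>a\<in>S. \<mu> A a \<ge> \<mu> A (f a a) \<and> \<gamma> A a \<le> \<gamma> A (f a a))"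

definition if_inter :: "'a set \<Rightarrow> 'a fuzzy_pair \<Rightarrow> 'a fuzzy_pair \<Rightarrow> 'a fuzzy_pair" where
  "if_inter S A B = (\<lambda>x\<in>S. min (\<mu> A x) (\<mu> B x), \<lambda>x\<in>S. max (\<gamma> A x) (\<gamma> B x))"

text \<open>For intuitionistic fuzzy sets the set under \<^const>\<open>Sup\<close> (\<^const>\<open>Inf\<close>) below is
  a non-empty subset of the unit interval, so the real supremum (infimum) is the intended one.\<close>

definition if_prod ::
  "'a set \<Rightarrow> ('a \<Rightarrow> 'a \<Rightarrow> 'a) \<Rightarrow> 'a fuzzy_pair \<Rightarrow> 'a fuzzy_pair \<Rightarrow> 'a fuzzy_pair" where
  "if_prod S f A B =
    (\<lambda>a\<in>S. if \<exists>b\<in>S. \<exists>c\<in>S. a = f b c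
           then Sup {min (\<mu> A b) (\<mu> B c) | b c. b \<in> S \<and> c \<in> S \<and> a = f b c} else 0,
     \<lambda>a\<in>S. if \<exists>b\<in>S. \<exists>c\<in>S. a = f b c
           then Inf {max (\<gamma> A b) (\<gamma> B c) | b c. b \<in> S \<and> c \<in> S \<and> a = f b c} else 1)"

end

theory Submission
  imports Defs
begin

text \<open>A left identity makes every right ideal, crisp or fuzzy, a left ideal, since
  \<open>sr = (es)r = (rs)e\<close>; so the product is always below the intersection. If
  \<open>a = (xa\<^sup>2)y\<close>, then \<open>a = (a(xa))y = (y(xa))a\<close>, a factorization at which the product attains
  the intersection. Conversely, \<open>a\<^sup>2S\<close> is a right ideal containing \<open>a\<^sup>2 = a\<^sup>2e\<close>; if it is semiprime,
  or its characteristic pair is, then \<open>a = a\<^sup>2s = (ea\<^sup>2)s\<close> for some \<open>s\<close>.\<close>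

locale ag_groupoid_left_identity = ag_groupoid +
  fixes e
  assumes left_identity: "left_identity S f e"
begin

lemma e_closed: "e \<in> S" and e_left: "a \<in> S \<Longrightarrow> e \<cdot> a = a"
  using left_identity by (auto simp: left_identity_def)

text \<open>Three uses of the left invertive law: on the whole product with
  \<open>c \<cdot> d\<close> as a single factor, inside on \<open>(c \<cdot> d) \<cdot> b\<close>,
  and on the whole again.\<close>

lemma medial:
  assumes "a \<in> S" "b \<in> S" "c \<in> S" "d \<in> S"
  shows "(a \<cdot> b) \<cdot> (c \<cdot> d) = (a \<cdot> c) \<cdot> (b \<cdot> d)"
proof -
  have "(a \<cdot> b) \<cdot> (c \<cdot> d) = ((c \<cdot> d) \<cdot> b) \<cdot> a"
    using assms by (intro left_invertive closed)
  also have "(c \<cdot> d) \<cdot> b = (b \<cdot> d) \<cdot> c"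
    using assms by (intro left_invertive)
  also have "((b \<cdot> d) \<cdot> c) \<cdot> a = (a \<cdot> c) \<cdot> (b \<cdot> d)"
    using assms by (intro left_invertive closed)
  finally show ?thesis .
qed

lemma left_commute:
  assumes "a \<in> S" "b \<in> S" "c \<in> S"
  shows "a \<cdot> (b \<cdot> c) = b \<cdot> (a \<cdot> c)"
  using assms medial[of e a b c] by (simp add: e_closed e_left)

lemma paramedial:
  assumes "a \<in> S" "b \<in> S" "c \<in> S" "d \<in> S"
  shows "(a \<cdot> b) \<cdot> (c \<cdot> d) = (d \<cdot> c) \<cdot> (b \<cdot> a)"
proof -
  \<comment> \<open>Right multiplication by \<open>e\<close> reverses a product:
    \<open>(v \<cdot> u) \<cdot> e = (e \<cdot> u) \<cdot> v\<close>. Reversing twice, with a medial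
    exchange in between, absorbs the extra \<open>e\<close>.\<close>
  have swap: "u \<cdot> v = (v \<cdot> u) \<cdot> e" if "u \<in> S" "v \<in> S" for u v
    using left_invertive[of v u e] that by (simp add: e_closed e_left)
  have "(a \<cdot> b) \<cdot> (c \<cdot> d) = (a \<cdot> c) \<cdot> (b \<cdot> d)"
    using assms by (rule medial)
  also have "\<dots> = ((b \<cdot> d) \<cdot> (a \<cdot> c)) \<cdot> e"
    using assms by (intro swap closed)
  also have "\<dots> = ((b \<cdot> a) \<cdot> (d \<cdot> c)) \<cdot> e"
    using assms by (simp add: medial)
  also have "\<dots> = (d \<cdot> c) \<cdot> (b \<cdot> a)"
    using assms by (intro swap[symmetric] closed)
  finally show ?thesis .
qed

text \<open>For intra-regular \<open>a\<close> this supplies the factorization used in both the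
  crisp and the fuzzy case: \<open>y \<cdot> (x \<cdot> a)\<close> arises from \<open>a\<close> by
  left multiplications, so it stays in any right ideal containing \<open>a\<close>, while the last
  factor is \<open>a\<close> itself.\<close>

lemma intra_regular_factor:
  assumes "a \<in> S" "x \<in> S" "y \<in> S"
  shows "(x \<cdot> (a \<cdot> a)) \<cdot> y = (y \<cdot> (x \<cdot> a)) \<cdot> a"
  using assms left_commute[of x a a] left_invertive[of a "x \<cdot> a" y] closed by simp

lemma right_idealD:
  assumes "right_ideal S f R" "r \<in> R" "s \<in> S"
  shows "r \<cdot> s \<in> R" "s \<cdot> r \<in> R"
proof -
  have right: "u \<cdot> t \<in> R" if "u \<in> R" "t \<in> S" for u t
    using assms(1) that by (auto simp: right_ideal_def set_mult_def)
  have r: "r \<in> S" using assms by (auto simp: right_ideal_def)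
  show "r \<cdot> s \<in> R" using assms right by blast
  then show "s \<cdot> r \<in> R"
    using right left_invertive[of e s r] e_closed e_left assms(3) r by metis
qed

lemma if_right_idealD:
  assumes "if_right_ideal S f A" "r \<in> S" "s \<in> S"
  shows "\<mu> A r \<le> \<mu> A (r \<cdot> s)" "\<gamma> A (r \<cdot> s) \<le> \<gamma> A r"
    and "\<mu> A r \<le> \<mu> A (s \<cdot> r)" "\<gamma> A (s \<cdot> r) \<le> \<gamma> A r"
proof -
  have right: "\<mu> A u \<le> \<mu> A (u \<cdot> t) \<and> \<gamma> A (u \<cdot> t) \<le> \<gamma> A u" if "u \<in> S" "t \<in> S" for u t
    using assms(1) that by (auto simp: if_right_ideal_def)
  have "s \<cdot> r = (r \<cdot> s) \<cdot> e"
    using left_invertive[of e s r] e_closed e_left assms(2,3) by metis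
  then show "\<mu> A r \<le> \<mu> A (r \<cdot> s)" "\<gamma> A (r \<cdot> s) \<le> \<gamma> A r"
    and "\<mu> A r \<le> \<mu> A (s \<cdot> r)" "\<gamma> A (s \<cdot> r) \<le> \<gamma> A r"
    using right[OF assms(2,3)] right[OF closed[OF assms(2,3)] e_closed] by auto
qed

lemma intra_regular_imp_ideals:
  assumes "intra_regular S f" "right_ideal S f R" "left_ideal S f L"
  shows "R \<inter> L = set_mult f R L" "semiprime S f R"
proof -
  have RS: "R \<subseteq> S" and LS: "L \<subseteq> S"
    using assms(2,3) by (auto simp: right_ideal_def left_ideal_def)
  have left: "s \<cdot> l \<in> L" if "s \<in> S" "l \<in> L" for s l
    using assms(3) that by (auto simp: left_ideal_def set_mult_def)
  show "R \<inter> L = set_mult f R L"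
  proof
    show "set_mult f R L \<subseteq> R \<inter> L"
      using RS LS left right_idealD(1)[OF assms(2)] unfolding set_mult_def by blast
    show "R \<inter> L \<subseteq> set_mult f R L"
    proof
      fix a assume a: "a \<in> R \<inter> L"
      then obtain x y where xy: "x \<in> S" "y \<in> S" "a = (x \<cdot> (a \<cdot> a)) \<cdot> y"
        using assms(1) RS unfolding intra_regular_def by blast
      then have "a = (y \<cdot> (x \<cdot> a)) \<cdot> a"
        using intra_regular_factor[of a x y] a RS by auto
      moreover have "y \<cdot> (x \<cdot> a) \<in> R"
        using a xy right_idealD(2)[OF assms(2)] by blast
      ultimately show "a \<in> set_mult f R L"
        using a unfolding set_mult_def by blast
    qed
  qed
  \<comment> \<open>If \<open>a \<cdot> a\<close> lies in \<open>R\<close>, so does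
    \<open>x \<cdot> (a \<cdot> a)\<close> by left multiplication, and then \<open>a\<close> after
    right multiplication by \<open>y\<close>.\<close>
  show "semiprime S f R"
    unfolding semiprime_def
    using assms(1) right_idealD[OF assms(2)] unfolding intra_regular_def by metis
qed

text \<open>Passing from \<open>a \<cdot> a\<close> to \<open>x \<cdot> (a \<cdot> a)\<close> and on
  to \<open>(x \<cdot> (a \<cdot> a)) \<cdot> y = a\<close> can only raise \<open>\<mu> A\<close>
  and lower \<open>\<gamma> A\<close>.\<close>

lemma intra_regular_imp_if_semiprime:
  assumes "intra_regular S f" "if_right_ideal S f A"
  shows "if_semiprime S f A"
  unfolding if_semiprime_def
proof (intro conjI ballI)
  show "ifs S A" using assms(2) by (simp add: if_right_ideal_def)
  fix a assume a: "a \<in> S"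
  then obtain x y where xy: "x \<in> S" "y \<in> S" "a = (x \<cdot> (a \<cdot> a)) \<cdot> y"
    using assms(1) unfolding intra_regular_def by blast
  have "\<mu> A (a \<cdot> a) \<le> \<mu> A (x \<cdot> (a \<cdot> a))" "\<mu> A (x \<cdot> (a \<cdot> a)) \<le> \<mu> A ((x \<cdot> (a \<cdot> a)) \<cdot> y)"
    "\<gamma> A (x \<cdot> (a \<cdot> a)) \<le> \<gamma> A (a \<cdot> a)" "\<gamma> A ((x \<cdot> (a \<cdot> a)) \<cdot> y) \<le> \<gamma> A (x \<cdot> (a \<cdot> a))"
    using if_right_idealD[OF assms(2)] a xy(1,2) closed by simp_all
  then show "\<mu> A (a \<cdot> a) \<le> \<mu> A a" "\<gamma> A a \<le> \<gamma> A (a \<cdot> a)"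
    using xy(3) by auto
qed

lemma intra_regular_imp_if_inter_eq_if_prod:
  assumes "intra_regular S f" "if_right_ideal S f A" "if_left_ideal S f B"
  shows "if_inter S A B = if_prod S f A B"
proof -
  note right = if_right_idealD[OF assms(2)]
  have left: "\<mu> B c \<le> \<mu> B (b \<cdot> c)" "\<gamma> B (b \<cdot> c) \<le> \<gamma> B c" if "b \<in> S" "c \<in> S" for b c
    using assms(3) that by (auto simp: if_left_ideal_def)
  \<comment> \<open>The last conjunct selects the branch of \<open>if_prod\<close> with
    \<open>Sup\<close> and \<open>Inf\<close>, so its default values 0 and 1 do not occur.\<close>
  have "Sup {min (\<mu> A b) (\<mu> B c) | b c. b \<in> S \<and> c \<in> S \<and> a = b \<cdot> c} = min (\<mu> A a) (\<mu> B a)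
      \<and> Inf {max (\<gamma> A b) (\<gamma> B c) | b c. b \<in> S \<and> c \<in> S \<and> a = b \<cdot> c} = max (\<gamma> A a) (\<gamma> B a)
      \<and> (\<exists>b\<in>S. \<exists>c\<in>S. a = b \<cdot> c)"
    if a: "a \<in> S" for a
  proof -
    obtain x y where xy: "x \<in> S" "y \<in> S" "a = (x \<cdot> (a \<cdot> a)) \<cdot> y"
      using assms(1) a unfolding intra_regular_def by blast
    define b where "b = y \<cdot> (x \<cdot> a)"
    have b: "b \<in> S" "a = b \<cdot> a"
      using intra_regular_factor[of a x y] xy a closed by (auto simp: b_def)
    have "\<mu> A a \<le> \<mu> A (x \<cdot> a)" "\<mu> A (x \<cdot> a) \<le> \<mu> A b"
      "\<gamma> A (x \<cdot> a) \<le> \<gamma> A a" "\<gamma> A b \<le> \<gamma> A (x \<cdot> a)"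
      using right(3,4) a xy(1,2) closed by (simp_all add: b_def)
    \<comment> \<open>This closes a cycle \<open>a\<close>, \<open>x \<cdot> a\<close>,
      \<open>b\<close>, \<open>b \<cdot> a = a\<close> along which \<open>\<mu> A\<close> cannot
      fall and \<open>\<gamma> A\<close> cannot rise; both are therefore constant on it.\<close>
    moreover have "\<mu> A b \<le> \<mu> A a" "\<gamma> A a \<le> \<gamma> A b"
      using right(1,2)[OF b(1) a] b(2) by auto
    ultimately have eq: "\<mu> A b = \<mu> A a" "\<gamma> A b = \<gamma> A a" by auto
    \<comment> \<open>Every factorization of \<open>a\<close> is bounded by the value of the
      intersection at \<open>a\<close>; the pair \<open>b\<close>, \<open>a\<close> attains this
      bound, making the supremum a maximum and the infimum a minimum.\<close>
    have le: "min (\<mu> A u) (\<mu> B v) \<le> min (\<mu> A (u \<cdot> v)) (\<mu> B (u \<cdot> v))"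
      "max (\<gamma> A (u \<cdot> v)) (\<gamma> B (u \<cdot> v)) \<le> max (\<gamma> A u) (\<gamma> B v)" if "u \<in> S" "v \<in> S" for u v
      using left[OF that] right(1,2)[OF that] by auto
    have "Sup {min (\<mu> A b) (\<mu> B c) | b c. b \<in> S \<and> c \<in> S \<and> a = b \<cdot> c} = min (\<mu> A a) (\<mu> B a)"
    proof (rule cSup_eq_maximum)
      show "min (\<mu> A a) (\<mu> B a) \<in> {min (\<mu> A b) (\<mu> B c) | b c. b \<in> S \<and> c \<in> S \<and> a = b \<cdot> c}"
        using a b eq(1) by (metis (mono_tags, lifting) mem_Collect_eq)
    qed (use le(1) in blast)
    moreover have "Inf {max (\<gamma> A b) (\<gamma> B c) | b c. b \<in> S \<and> c \<in> S \<and> a = b \<cdot> c} = max (\<gamma> A a) (\<gamma> B a)"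
    proof (rule cInf_eq_minimum)
      show "max (\<gamma> A a) (\<gamma> B a) \<in> {max (\<gamma> A b) (\<gamma> B c) | b c. b \<in> S \<and> c \<in> S \<and> a = b \<cdot> c}"
        using a b eq(2) by (metis (mono_tags, lifting) mem_Collect_eq)
    qed (use le(2) in blast)
    ultimately show ?thesis using a b by blast
  qed
  then show ?thesis
    unfolding if_inter_def if_prod_def by (auto intro!: restrict_ext)
qed

text \<open>A square associates with right factors: the left invertive law turns
  \<open>((a \<cdot> a) \<cdot> s) \<cdot> t\<close> into
  \<open>(t \<cdot> s) \<cdot> (a \<cdot> a)\<close>, and paramediality reverses this to
  \<open>(a \<cdot> a) \<cdot> (s \<cdot> t)\<close>.\<close>

lemma right_ideal_square_mult:
  assumes "a \<in> S"
  shows "right_ideal S f (set_mult f {a \<cdot> a} S)"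
proof -
  have "((a \<cdot> a) \<cdot> s) \<cdot> t = (a \<cdot> a) \<cdot> (s \<cdot> t)" if "s \<in> S" "t \<in> S" for s t
    using that assms paramedial[of t s a a] left_invertive[of "a \<cdot> a" s t] closed by simp
  then show ?thesis
    using assms nonempty closed by (auto simp: right_ideal_def set_mult_def)
qed

lemma square_in_square_mult:
  assumes "a \<in> S"
  shows "a \<cdot> a \<in> set_mult f {a \<cdot> a} S"
proof -
  \<comment> \<open>Paramediality gives \<open>(e \<cdot> e) \<cdot> (a \<cdot> a) = (a \<cdot> a)
    \<cdot> (e \<cdot> e)\<close>, so \<open>e\<close> fixes squares from the right too.\<close>
  have "a \<cdot> a = (a \<cdot> a) \<cdot> e"
    using assms paramedial[of e e a a] closed e_closed e_left by metis
  then show ?thesis using e_closed by (auto simp: set_mult_def)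
qed

lemma intra_regularI:
  assumes "\<And>a. a \<in> S \<Longrightarrow> a \<in> set_mult f {a \<cdot> a} S"
  shows "intra_regular S f"
  unfolding intra_regular_def
proof
  fix a assume a: "a \<in> S"
  then obtain s where "s \<in> S" "a = (a \<cdot> a) \<cdot> s"
    using assms by (auto simp: set_mult_def)
  then show "\<exists>x\<in>S. \<exists>y\<in>S. a = (x \<cdot> (a \<cdot> a)) \<cdot> y"
    using a closed e_closed e_left by metis
qed

text \<open>The ideal conditions speak of pairs, so extracting semiprimeness of a right ideal
  requires some left ideal as partner. The carrier serves here, and its characteristic pair serves
  in the fuzzy case.\<close>

lemma left_ideal_carrier: "left_ideal S f S"
  using nonempty closed by (auto simp: left_ideal_def set_mult_def)

lemma if_left_ideal_constant: "if_left_ideal S f (\<lambda>x\<in>S. 1, \<lambda>x\<in>S. 0)"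
  using closed by (auto simp: if_left_ideal_def ifs_def)

lemma if_right_ideal_characteristic:
  assumes "right_ideal S f R"
  shows "if_right_ideal S f (\<lambda>x\<in>S. of_bool (x \<in> R), \<lambda>x\<in>S. of_bool (x \<notin> R))"
  using right_idealD(1)[OF assms] closed by (auto simp: if_right_ideal_def ifs_def)

lemma intra_regular_iff_ideals:
  "intra_regular S f \<longleftrightarrow>
    (\<forall>R L. right_ideal S f R \<and> left_ideal S f L \<longrightarrow> R \<inter> L = set_mult f R L \<and> semiprime S f R)"
    (is "_ \<longleftrightarrow> ?ideals")
proof
  show "intra_regular S f \<Longrightarrow> ?ideals"
    using intra_regular_imp_ideals by blast
  show "intra_regular S f" if ?ideals
  proof (rule intra_regularI)
    fix a assume a: "a \<in> S"
    then have "semiprime S f (set_mult f {a \<cdot> a} S)"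
      using that right_ideal_square_mult left_ideal_carrier by blast
    then show "a \<in> set_mult f {a \<cdot> a} S"
      using a square_in_square_mult by (simp add: semiprime_def)
  qed
qed

lemma intra_regular_iff_if_ideals:
  "intra_regular S f \<longleftrightarrow>
    (\<forall>A B. if_right_ideal S f A \<and> if_left_ideal S f B \<longrightarrow>
      if_inter S A B = if_prod S f A B \<and> if_semiprime S f A)"
    (is "_ \<longleftrightarrow> ?fuzzy")
proof
  show "intra_regular S f \<Longrightarrow> ?fuzzy"
    using intra_regular_imp_if_inter_eq_if_prod intra_regular_imp_if_semiprime by blast
  show "intra_regular S f" if ?fuzzy
  proof (rule intra_regularI)
    fix a assume a: "a \<in> S"
    let ?R = "set_mult f {a \<cdot> a} S"
    let ?A = "(\<lambda>x\<in>S. of_bool (x \<in> ?R), \<lambda>x\<in>S. of_bool (x \<notin> ?R)) :: 'a fuzzy_pair"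
    have "if_semiprime S f ?A"
      using that if_right_ideal_characteristic[OF right_ideal_square_mult[OF a]]
        if_left_ideal_constant by blast
    \<comment> \<open>The left side is 1, as \<open>a \<cdot> a\<close> lies in \<open>?R\<close>;
      an indicator that is at least 1 at \<open>a\<close> puts \<open>a\<close> in
      \<open>?R\<close>.\<close>
    then have "\<mu> ?A (a \<cdot> a) \<le> \<mu> ?A a"
      using a unfolding if_semiprime_def by blast
    then show "a \<in> ?R"
      using square_in_square_mult[OF a] a closed[OF a a] by (simp split: split_of_bool_asm)
  qed
qed

end

theorem theorem12:
  fixes S :: "'a set" and f :: "'a \<Rightarrow> 'a \<Rightarrow> 'a"
  assumes "ag_groupoid S f" and "\<exists>e. left_identity S f e"
  shows "(intra_regular S f \<longleftrightarrow>
            (\<forall>R L. right_ideal S f R \<and> left_ideal S f L \<longrightarrow>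
               R \<inter> L = set_mult f R L \<and> semiprime S f R)) \<and>
         ((\<forall>R L. right_ideal S f R \<and> left_ideal S f L \<longrightarrow>
               R \<inter> L = set_mult f R L \<and> semiprime S f R) \<longleftrightarrow>
            (\<forall>A B. if_right_ideal S f A \<and> if_left_ideal S f B \<longrightarrow>
               if_inter S A B = if_prod S f A B \<and> if_semiprime S f A))"
proof -
  from assms(2) obtain e where "left_identity S f e" ..
  with assms(1) interpret ag_groupoid_left_identity S f e
    by (simp add: ag_groupoid_left_identity_def ag_groupoid_left_identity_axioms_def)
  \<comment> \<open>The crisp and the fuzzy condition are linked through intra-regularity, to which
    each is equivalent.\<close>
  show ?thesis
    using intra_regular_iff_ideals intra_regular_iff_if_ideals by argo
qed

end
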